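(* Let $G$ be a compact group acting measurably on a sample space $\mathcal X$, and let $\pi:\mathcal X\to\mathcal X/G$ be the quotient map sending each point to its orbit. Let $\{P_\theta:\theta\in\Theta\}$ be a dominated statistical family on $\mathcal X$ with densities $p_\theta(x)$ with respect to the dominating measure. Suppose that $$p_\theta(gx)=p_\theta(x)\quad\text{for all } g\in G,\ x\in\mathcal X,\ \theta\in\Theta,$$ and assume in addition that distinct orbits are statistically distinguishable: for all $x,x'\in\mathcal X$, $$\pi(x)\neq\pi(x')\quad\Longrightarrow\quad \frac{p_\theta(x)}{p_\theta(x')}\ \text{ is not constant in }\theta.$$ Then, for $X\sim P_\theta$, the statistic $\pi(X)$ is minimal sufficient for $\theta$.
   Context: The sample space $\mathcal X$ is a measurable space. $\mathcal X/G$ is the set of orbits $[x]=Gx=\{gx:g\in G\}$, with $\pi(x)=[x]$, equipped with the quotient $\sigma$-algebra (a set $B\subseteq\mathcal X/G$ is measurable iff $\pi^{-1}(B)$ is measurable in $\mathcal X$). "Dominated" means that there is a $\sigma$-finite measure $\mu$ on $\mathcal X$ such that every $P_\theta$ is absolutely continuous with respect to $\mu$; $p_\theta=dP_\theta/d\mu$ denotes a fixed version of the density. A statistic $T(X)$ is sufficient for $\theta$ if the conditional distribution of $X$ given $T(X)$ does not depend on $\theta$. It is minimal sufficient if it is sufficient and is a function of every other sufficient statistic. Statements about likelihood ratios are understood up to the usual qualifications on null sets and points where the denominator vanishes.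
   Formalization: Distinguishability of orbits is required for every version of the densities, off a set null for the whole family, since for uncountable Θ the condition on one fixed version does not suffice; "is a function of every other sufficient statistic" is meant off such a null set. *)

theory Defs
  imports "HOL-Probability.Probability" "HOL-Algebra.Group_Action"
begin

section \<open>Compact groups acting measurably\<close>

definition borel_of :: "'a topology \<Rightarrow> 'a measure" where
  "borel_of \<tau> = sigma (topspace \<tau>) {U. openin \<tau> U}"

text \<open>No separation axiom is imposed on the topology, so that both usual conventions for compact
  groups (with or without Hausdorff) are covered.\<close>

definition compact_group :: "('g, 'm) monoid_scheme \<Rightarrow> 'g topology \<Rightarrow> bool" where
  "compact_group G \<tau> \<longleftrightarrow>
     group G \<and> topspace \<tau> = carrier G \<and> compact_space \<tau> \<and>
     continuous_map (prod_topology \<tau> \<tau>) \<tau> (\<lambda>(g, h). g \<otimes>\<^bsub>G\<^esub> h) \<and>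
     continuous_map \<tau> \<tau> (\<lambda>g. inv\<^bsub>G\<^esub> g)"

definition measurable_action ::
    "('g, 'm) monoid_scheme \<Rightarrow> 'g topology \<Rightarrow> 'a measure \<Rightarrow> ('g \<Rightarrow> 'a \<Rightarrow> 'a) \<Rightarrow> bool" where
  "measurable_action G \<tau> M \<phi> \<longleftrightarrow>
     group_action G (space M) \<phi> \<and>
     (\<lambda>(g, x). \<phi> g x) \<in> borel_of \<tau> \<Otimes>\<^sub>M M \<rightarrow>\<^sub>M M"

text \<open>The quotient map is \<^term>\<open>orbit G \<phi>\<close>; the orbit space carries the quotient
  \<open>\<sigma>\<close>-algebra. Its measure component (zero) plays no role.\<close>

definition orbit_space ::
    "('g, 'm) monoid_scheme \<Rightarrow> 'a measure \<Rightarrow> ('g \<Rightarrow> 'a \<Rightarrow> 'a) \<Rightarrow> 'a set measure" where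
  "orbit_space G M \<phi> =
     sigma (orbits G (space M) \<phi>)
       {B. B \<subseteq> orbits G (space M) \<phi> \<and> orbit G \<phi> -` B \<inter> space M \<in> sets M}"

lemma space_orbit_space: "space (orbit_space G M \<phi>) = orbits G (space M) \<phi>"
  unfolding orbit_space_def by (rule space_measure_of) auto

text \<open>The generating family is already a \<open>\<sigma>\<close>-algebra.\<close>

lemma sets_orbit_space:
  fixes M :: "'a measure"
  shows "sets (orbit_space G M \<phi>) =
     {B. B \<subseteq> orbits G (space M) \<phi> \<and> orbit G \<phi> -` B \<inter> space M \<in> sets M}"
proof -
  let ?O = "orbits G (space M) \<phi>" and ?\<pi> = "orbit G \<phi>"
  have in_O: "?\<pi> x \<in> ?O" if "x \<in> space M" for x
    using that by (auto simp: orbits_def)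
  have "sigma_algebra ?O {B. B \<subseteq> ?O \<and> ?\<pi> -` B \<inter> space M \<in> sets M}"
    unfolding sigma_algebra_iff2
  proof (intro conjI ballI allI impI)
    fix B assume B: "B \<in> {B. B \<subseteq> ?O \<and> ?\<pi> -` B \<inter> space M \<in> sets M}"
    have "?\<pi> -` (?O - B) \<inter> space M = space M - (?\<pi> -` B \<inter> space M)"
      using in_O by auto
    then show "?O - B \<in> {B. B \<subseteq> ?O \<and> ?\<pi> -` B \<inter> space M \<in> sets M}"
      using B by auto
  next
    fix A :: "nat \<Rightarrow> 'a set set"
    assume A: "range A \<subseteq> {B. B \<subseteq> ?O \<and> ?\<pi> -` B \<inter> space M \<in> sets M}"
    have "?\<pi> -` (\<Union>i. A i) \<inter> space M = (\<Union>i. ?\<pi> -` A i \<inter> space M)"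
      by auto
    also have "\<dots> \<in> sets M"
      using A by (intro sets.countable_UN) auto
    finally show "(\<Union>i. A i) \<in> {B. B \<subseteq> ?O \<and> ?\<pi> -` B \<inter> space M \<in> sets M}"
      using A by auto
  qed auto
  then show ?thesis
    unfolding orbit_space_def by (simp add: sigma_algebra.sigma_sets_eq subset_iff)
qed

section \<open>Dominated statistical families\<close>

definition dominated_family ::
    "'a measure \<Rightarrow> 't set \<Rightarrow> ('t \<Rightarrow> 'a measure) \<Rightarrow> 'a measure \<Rightarrow> bool" where
  "dominated_family M \<Theta> P \<mu> \<longleftrightarrow>
     sigma_finite_measure \<mu> \<and> sets \<mu> = sets M \<and>
     (\<forall>\<theta>\<in>\<Theta>. prob_space (P \<theta>) \<and> sets (P \<theta>) = sets M \<and> absolutely_continuous \<mu> (P \<theta>))"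

definition density_versions ::
    "'t set \<Rightarrow> ('t \<Rightarrow> 'a measure) \<Rightarrow> 'a measure \<Rightarrow> ('t \<Rightarrow> 'a \<Rightarrow> real) \<Rightarrow> bool" where
  "density_versions \<Theta> P \<mu> p \<longleftrightarrow>
     (\<forall>\<theta>\<in>\<Theta>. p \<theta> \<in> borel_measurable \<mu> \<and> (\<forall>x\<in>space \<mu>. 0 \<le> p \<theta> x) \<and>
        P \<theta> = density \<mu> (\<lambda>x. ennreal (p \<theta> x)))"

definition family_null_sets ::
    "'a measure \<Rightarrow> 't set \<Rightarrow> ('t \<Rightarrow> 'a measure) \<Rightarrow> 'a set set" where
  "family_null_sets M \<Theta> P = {Z \<in> sets M. \<forall>\<theta>\<in>\<Theta>. emeasure (P \<theta>) Z = 0}"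

text \<open>The ratio is taken in \<^typ>\<open>ennreal\<close>, where \<open>a / 0 = \<infinity>\<close> for \<open>a > 0\<close>. Parameters at which
  the ratio has the undetermined form \<open>0 / 0\<close> are disregarded.\<close>

definition likelihood_ratio_constant ::
    "'t set \<Rightarrow> ('t \<Rightarrow> 'a \<Rightarrow> real) \<Rightarrow> 'a \<Rightarrow> 'a \<Rightarrow> bool" where
  "likelihood_ratio_constant \<Theta> p x x' \<longleftrightarrow>
     (\<exists>c::ennreal. \<forall>\<theta>\<in>\<Theta>. \<not> (p \<theta> x = 0 \<and> p \<theta> x' = 0) \<longrightarrow>
        ennreal (p \<theta> x) / ennreal (p \<theta> x') = c)"

text \<open>Each density is determined only up to a null set that may depend on the parameter, so
  the condition that the likelihood ratio of points in distinct orbits is not constant is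
  required up to null sets in the following version-independent sense: whichever versions are
  taken, it holds for all pairs of points outside one set that is null for the whole family.
  For uncountable \<open>\<Theta>\<close> the pointwise condition on a single choice of versions carries no information
  about the family: for \<open>P\<^sub>\<theta> = N(0,1)\<close>, \<open>\<theta> \<in> \<real>\<close>, doubling the \<open>\<theta>\<close>-th version of the density at
  the point \<open>\<theta>\<close> makes all ratios non-constant, although every statistic is sufficient.\<close>

definition orbits_distinguishable ::
    "('g, 'm) monoid_scheme \<Rightarrow> 'a measure \<Rightarrow> ('g \<Rightarrow> 'a \<Rightarrow> 'a) \<Rightarrow> 't set \<Rightarrow> ('t \<Rightarrow> 'a measure) \<Rightarrow>
      'a measure \<Rightarrow> bool" where
  "orbits_distinguishable G M \<phi> \<Theta> P \<mu> \<longleftrightarrow>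
     (\<forall>p. density_versions \<Theta> P \<mu> p \<longrightarrow>
        (\<exists>Z\<in>family_null_sets M \<Theta> P. \<forall>x\<in>space M - Z. \<forall>x'\<in>space M - Z.
           orbit G \<phi> x \<noteq> orbit G \<phi> x' \<longrightarrow> \<not> likelihood_ratio_constant \<Theta> p x x'))"

text \<open>If the ratios of one choice of versions are already non-constant on a countable set of
  parameters (in particular, if \<open>\<Theta>\<close> itself is countable), then the pointwise condition on that
  choice suffices.\<close>

lemma orbits_distinguishable_countable:
  assumes dom: "dominated_family M \<Theta> P \<mu>"
    and p: "density_versions \<Theta> P \<mu> p"
    and \<Theta>\<^sub>0: "countable \<Theta>\<^sub>0" "\<Theta>\<^sub>0 \<subseteq> \<Theta>"
    and dist: "\<And>x x'. x \<in> space M \<Longrightarrow> x' \<in> space M \<Longrightarrow> orbit G \<phi> x \<noteq> orbit G \<phi> x' \<Longrightarrow>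
      \<not> likelihood_ratio_constant \<Theta>\<^sub>0 p x x'"
  shows "orbits_distinguishable G M \<phi> \<Theta> P \<mu>"
  unfolding orbits_distinguishable_def
proof (intro allI impI)
  fix q assume q: "density_versions \<Theta> P \<mu> q"
  interpret sigma_finite_measure \<mu>
    using dom by (simp add: dominated_family_def)
  have sets_\<mu>: "sets \<mu> = sets M"
    using dom by (simp add: dominated_family_def)
  have space_\<mu>: "space \<mu> = space M"
    by (rule sets_eq_imp_space_eq[OF sets_\<mu>])
  define Z where "Z = (\<Union>\<theta>\<in>\<Theta>\<^sub>0. {x \<in> space \<mu>. p \<theta> x \<noteq> q \<theta> x})"
  have "{x \<in> space \<mu>. p \<theta> x \<noteq> q \<theta> x} \<in> null_sets \<mu>" if "\<theta> \<in> \<Theta>\<^sub>0" for \<theta>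
  proof -
    have \<theta>: "\<theta> \<in> \<Theta>" using that \<Theta>\<^sub>0 by auto
    have [measurable]: "p \<theta> \<in> borel_measurable \<mu>" "q \<theta> \<in> borel_measurable \<mu>"
      using p q \<theta> by (auto simp: density_versions_def)
    have nonneg: "\<forall>x\<in>space \<mu>. 0 \<le> p \<theta> x \<and> 0 \<le> q \<theta> x"
      using p q \<theta> by (auto simp: density_versions_def)
    have "density \<mu> (\<lambda>x. ennreal (p \<theta> x)) = density \<mu> (\<lambda>x. ennreal (q \<theta> x))"
      using p q \<theta> unfolding density_versions_def by metis
    then have "AE x in \<mu>. ennreal (p \<theta> x) = ennreal (q \<theta> x)"
      by (subst (asm) density_unique_iff) auto
    then have "AE x in \<mu>. p \<theta> x = q \<theta> x"
      using AE_space by eventually_elim (use nonneg in auto)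
    then show ?thesis
      by (subst (asm) AE_iff_null) auto
  qed
  then have Z: "Z \<in> null_sets \<mu>"
    unfolding Z_def using \<Theta>\<^sub>0(1) by (intro null_sets_UN') auto
  then have "Z \<in> family_null_sets M \<Theta> P"
    using dom
    by (fastforce simp: family_null_sets_def dominated_family_def absolutely_continuous_def null_sets_def)
  moreover have "\<not> likelihood_ratio_constant \<Theta> q x x'"
    if x: "x \<in> space M - Z" "x' \<in> space M - Z" and orb: "orbit G \<phi> x \<noteq> orbit G \<phi> x'" for x x'
  proof
    assume "likelihood_ratio_constant \<Theta> q x x'"
    then have "likelihood_ratio_constant \<Theta>\<^sub>0 q x x'"
      using \<Theta>\<^sub>0(2) unfolding likelihood_ratio_constant_def by blast
    moreover have "p \<theta> x = q \<theta> x" "p \<theta> x' = q \<theta> x'" if "\<theta> \<in> \<Theta>\<^sub>0" for \<theta>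
      using x that by (auto simp: Z_def space_\<mu>)
    ultimately have "likelihood_ratio_constant \<Theta>\<^sub>0 p x x'"
      unfolding likelihood_ratio_constant_def by simp
    then show False
      using dist x orb by blast
  qed
  ultimately show "\<exists>Z\<in>family_null_sets M \<Theta> P. \<forall>x\<in>space M - Z. \<forall>x'\<in>space M - Z.
      orbit G \<phi> x \<noteq> orbit G \<phi> x' \<longrightarrow> \<not> likelihood_ratio_constant \<Theta> q x x'"
    by blast
qed

section \<open>Minimal sufficiency\<close>

text \<open>Statistics take values in a measurable space \<open>N\<close>. Regular conditional distributions need
  not exist on a general sample space, so the conditional distribution given \<open>T\<close> is the system
  of conditional probabilities of measurable events given the \<open>\<sigma>\<close>-algebra generated by \<open>T\<close>:
  for every event there must be a common version for all parameters.\<close>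

definition sufficient_statistic ::
    "'a measure \<Rightarrow> 't set \<Rightarrow> ('t \<Rightarrow> 'a measure) \<Rightarrow> 'b measure \<Rightarrow> ('a \<Rightarrow> 'b) \<Rightarrow> bool" where
  "sufficient_statistic M \<Theta> P N T \<longleftrightarrow>
     T \<in> M \<rightarrow>\<^sub>M N \<and>
     (\<forall>A\<in>sets M. \<exists>k\<in>borel_measurable N. \<forall>\<theta>\<in>\<Theta>. AE x in P \<theta>.
        real_cond_exp (P \<theta>) (vimage_algebra (space M) T N) (indicator A) x = k (T x))"

text \<open>The type argument is the value type of the competing statistics; it is arbitrary, but HOL
  cannot quantify over it within the definition. As usual, being a function of another statistic
  is meant up to a set that is null for the whole family, and the function is not required to be
  measurable.\<close>

definition minimal_sufficient_statistic ::
    "'c itself \<Rightarrow> 'a measure \<Rightarrow> 't set \<Rightarrow> ('t \<Rightarrow> 'a measure) \<Rightarrow> 'b measure \<Rightarrow> ('a \<Rightarrow> 'b) \<Rightarrow> bool"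
  where
  "minimal_sufficient_statistic (_ :: 'c itself) M \<Theta> P N S \<longleftrightarrow>
     sufficient_statistic M \<Theta> P N S \<and>
     (\<forall>(K :: 'c measure) T. sufficient_statistic M \<Theta> P K T \<longrightarrow>
        (\<exists>f. \<exists>Z\<in>family_null_sets M \<Theta> P. \<forall>x\<in>space M - Z. S x = f (T x)))"

end

theory Submission
  imports Defs
begin

text \<open>
  The proof rests on the Halmos--Savage form of the factorization theorem. A dominated family
  has a mixture \<open>L = \<Sum>i. 2\<^sup>-\<^sup>(\<^sup>i\<^sup>+\<^sup>1\<^sup>) P\<^bsub>t i\<^esub>\<close> of countably many of its members that dominates every
  member (\<open>exists_equivalent_mixture\<close>), and a statistic \<open>T\<close> is sufficient if and only if every
  member has a density with respect to \<open>L\<close> that is a function of \<open>T\<close>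
  (\<open>sufficient_statistic_if_densities_factor\<close>, \<open>sufficient_statistic_imp_densities_factor\<close>). Let
  \<open>m = dL/d\<mu> = \<Sum>i. 2\<^sup>-\<^sup>(\<^sup>i\<^sup>+\<^sup>1\<^sup>) p\<^bsub>t i\<^esub>\<close>.

  Sufficiency of the orbit map: the function \<open>p\<^sub>\<theta> / m\<close> is a density of \<open>P\<^sub>\<theta>\<close> with respect to \<open>L\<close>.
  It is built from invariant functions, so it is invariant, and the quotient \<open>\<sigma>\<close>-algebra is
  exactly large enough for invariant measurable functions to be measurable functions of the orbit.

  Minimality: if \<open>T\<close> is sufficient, then \<open>P\<^sub>\<theta>\<close> has a density \<open>D\<^sub>\<theta> \<circ> T\<close> with respect to \<open>L\<close>, so that
  \<open>m \<sqdot> (D\<^sub>\<theta> \<circ> T)\<close> is another version of \<open>dP\<^sub>\<theta>/d\<mu>\<close>. For this version the likelihood ratio of two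
  points with \<open>T x = T x'\<close> is \<open>m x / m x'\<close>, whatever \<open>\<theta>\<close> is. Outside a set that is null for the
  whole family, distinct orbits have non-constant ratios, so such points lie in the same orbit.
  In other words, the orbit is a function of \<open>T\<close>.
\<close>

section \<open>Conditional probabilities given a statistic\<close>

lemma subalgebra_vimage_algebra:
  assumes "T \<in> M \<rightarrow>\<^sub>M N"
  shows "subalgebra M (vimage_algebra (space M) T N)"
  using assms measurable_space[OF assms]
  by (auto simp: subalgebra_def sets_vimage_algebra2 Pi_iff)

text \<open>Sufficiency is defined through \<^const>\<open>real_cond_exp\<close>, but mixtures and changes of measure
  are easiest for nonnegative integrals of arbitrary functions \<open>u \<circ> T\<close>. This lemma and its converse
  \<open>cond_prob_eqI\<close> translate between the two.\<close>

lemma nn_integral_cond_prob: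
  fixes u :: "'b \<Rightarrow> ennreal" and k :: "'b \<Rightarrow> real"
  assumes "prob_space P" and T: "T \<in> P \<rightarrow>\<^sub>M N" and A: "A \<in> sets P"
    and u: "u \<in> borel_measurable N"
    and k: "AE x in P. real_cond_exp P (vimage_algebra (space P) T N) (indicator A) x = k (T x)"
  shows "(\<integral>\<^sup>+x. u (T x) * ennreal (k (T x)) \<partial>P) = (\<integral>\<^sup>+x. u (T x) * indicator A x \<partial>P)"
proof -
  let ?F = "vimage_algebra (space P) T N"
  interpret prob_space P by fact
  interpret finite_measure_subalgebra P ?F
    by unfold_locales (rule subalgebra_vimage_algebra[OF T])
  have [measurable]: "T \<in> ?F \<rightarrow>\<^sub>M N"
    using measurable_space[OF T] by (intro measurable_vimage_algebra1) auto
  note [measurable] = A u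
  let ?E = "nn_cond_exp P ?F (\<lambda>x. ennreal (indicator A x))"
  have "(\<integral>\<^sup>+x. 1 * ?E x \<partial>P) = (\<integral>\<^sup>+x. 1 * ennreal (indicator A x) \<partial>P)"
    by (rule nn_cond_exp_intg) auto
  also have "\<dots> = emeasure P A"
    by (simp add: ennreal_indicator)
  finally have "AE x in P. ?E x \<noteq> \<infinity>"
    by (intro nn_integral_PInf_AE) auto
  moreover have "AE x in P. nn_cond_exp P ?F (\<lambda>x. ennreal (- indicator A x)) x = 0"
    using nn_cond_exp_F_meas[of "\<lambda>x. 0"] by (simp add: ennreal_neg)
  ultimately have eq: "AE x in P. ennreal (k (T x)) = ?E x"
    using k
  proof eventually_elim
    case (elim x)
    then have "k (T x) = enn2real (?E x)"
      by (simp add: real_cond_exp_def)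
    with elim show ?case
      by (simp add: less_top)
  qed
  have "(\<integral>\<^sup>+x. u (T x) * ennreal (k (T x)) \<partial>P) = (\<integral>\<^sup>+x. u (T x) * ?E x \<partial>P)"
    using eq by (intro nn_integral_cong_AE) auto
  also have "\<dots> = (\<integral>\<^sup>+x. u (T x) * ennreal (indicator A x) \<partial>P)"
    by (rule nn_cond_exp_intg) auto
  finally show ?thesis by (simp add: ennreal_indicator)
qed

lemma cond_prob_eqI:
  fixes k :: "'b \<Rightarrow> real"
  assumes "prob_space P" and T: "T \<in> P \<rightarrow>\<^sub>M N" and A: "A \<in> sets P"
    and k: "k \<in> borel_measurable N" and k_nonneg: "\<And>y. 0 \<le> k y"
    and eq: "\<And>u :: 'b \<Rightarrow> ennreal. u \<in> borel_measurable N \<Longrightarrow>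
      (\<integral>\<^sup>+x. u (T x) * ennreal (k (T x)) \<partial>P) = (\<integral>\<^sup>+x. u (T x) * indicator A x \<partial>P)"
  shows "AE x in P. real_cond_exp P (vimage_algebra (space P) T N) (indicator A) x = k (T x)"
proof -
  let ?F = "vimage_algebra (space P) T N"
  interpret prob_space P by fact
  interpret finite_measure_subalgebra P ?F
    by unfold_locales (rule subalgebra_vimage_algebra[OF T])
  have TF [measurable]: "T \<in> ?F \<rightarrow>\<^sub>M N"
    using measurable_space[OF T] by (intro measurable_vimage_algebra1) auto
  note [measurable] = A k T
  show ?thesis
  proof (rule real_cond_exp_charact)
    show "integrable P (indicator A :: _ \<Rightarrow> real)"
      by (rule integrable_real_indicator) (auto simp: less_top[symmetric])
    show "integrable P (\<lambda>x. k (T x))"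
    proof (rule integrableI_nonneg)
      show "(\<integral>\<^sup>+x. ennreal (k (T x)) \<partial>P) < \<infinity>"
        using eq[of "\<lambda>_. 1"] by (simp add: less_top[symmetric])
    qed (auto simp: k_nonneg)
    fix S assume "S \<in> sets ?F"
    then obtain B where B [measurable]: "B \<in> sets N" and S: "S = T -` B \<inter> space P"
      using measurable_space[OF T] by (auto simp: sets_vimage_algebra2 Pi_iff)
    have [measurable]: "S \<in> sets P" unfolding S by measurable
    have ind: "indicator S x = (indicator B (T x) :: ennreal)" if "x \<in> space P" for x
      using that by (simp add: S indicator_def)
    have "(\<integral>\<^sup>+x. ennreal (indicator S x * indicator A x) \<partial>P)
        = (\<integral>\<^sup>+x. indicator B (T x) * indicator A x \<partial>P)"
      by (intro nn_integral_cong) (auto simp: ennreal_mult ennreal_indicator ind)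
    also have "\<dots> = (\<integral>\<^sup>+x. indicator B (T x) * ennreal (k (T x)) \<partial>P)"
      by (rule eq[symmetric]) auto
    also have "\<dots> = (\<integral>\<^sup>+x. ennreal (indicator S x * k (T x)) \<partial>P)"
      by (intro nn_integral_cong) (auto simp: ennreal_mult k_nonneg ennreal_indicator ind)
    finally show "(\<integral>x\<in>S. indicator A x \<partial>P) = (\<integral>x\<in>S. k (T x) \<partial>P)"
      unfolding set_lebesgue_integral_def
      by (simp add: integral_eq_nn_integral k_nonneg)
  qed auto
qed

section \<open>Sufficiency relative to a dominating finite measure\<close>

text \<open>A conditional probability \<open>k \<circ> T\<close> of \<open>A\<close> under \<open>L\<close> satisfies
  \<open>\<integral> v(T) k(T) dL = \<integral> v(T) 1\<^sub>A dL\<close> for all \<open>v\<close>; taking \<open>v = q\<^sub>\<theta> u\<close> shows that it is also a conditional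
  probability under \<open>P\<^sub>\<theta>\<close>. The function \<open>k\<close> comes from the Radon--Nikodym theorem on the value space
  of \<open>T\<close>, so that it is measurable there by construction.\<close>

lemma sufficient_statistic_if_densities_factor:
  fixes q :: "'t \<Rightarrow> 'b \<Rightarrow> ennreal"
  assumes "finite_measure L" and sets_L: "sets L = sets M"
    and P: "\<And>\<theta>. \<theta> \<in> \<Theta> \<Longrightarrow> prob_space (P \<theta>)"
    and T: "T \<in> M \<rightarrow>\<^sub>M N"
    and q: "\<And>\<theta>. \<theta> \<in> \<Theta> \<Longrightarrow> q \<theta> \<in> borel_measurable N"
    and dens: "\<And>\<theta>. \<theta> \<in> \<Theta> \<Longrightarrow> P \<theta> = density L (\<lambda>x. q \<theta> (T x))"
  shows "sufficient_statistic M \<Theta> P N T"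
  unfolding sufficient_statistic_def
proof (intro conjI ballI)
  fix A assume "A \<in> sets M"
  then have A [measurable]: "A \<in> sets L" by (simp add: sets_L)
  interpret finite_measure L by fact
  have TL [measurable]: "T \<in> L \<rightarrow>\<^sub>M N"
    using T by (simp add: measurable_cong_sets[OF sets_L refl])
  let ?L = "distr L N T" and ?LA = "distr (density L (indicator A)) N T"
  interpret D: finite_measure ?L by (rule finite_measure_distr) fact
  have fin: "finite_measure ?LA"
    by (intro finite_measure.finite_measure_distr finite_measureI)
       (auto simp: emeasure_density nn_integral_cmult simp flip: indicator_inter_arith)
  have ac: "absolutely_continuous ?L ?LA"
    unfolding absolutely_continuous_def
  proof
    fix B assume "B \<in> null_sets ?L"
    then have B: "B \<in> sets N" and 0: "emeasure L (T -` B \<inter> space L) = 0"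
      by (auto simp: null_sets_def emeasure_distr)
    have "T -` B \<inter> space L \<in> null_sets L"
      using 0 B by (auto simp: null_sets_def)
    then have "T -` B \<inter> space L \<in> null_sets (density L (indicator A))"
      using absolutely_continuousI_density[of "indicator A" L]
      by (auto simp: absolutely_continuous_def)
    then show "B \<in> null_sets ?LA"
      using B by (auto simp: null_sets_def emeasure_distr)
  qed
  obtain k where k: "k \<in> borel_measurable ?L" "AE y in ?L. RN_deriv ?L ?LA y = ennreal (k y)"
      "\<And>y. 0 \<le> k y"
    using D.real_RN_deriv[OF fin ac] by auto
  have kN [measurable]: "k \<in> borel_measurable N" using k(1) by simp
  have LA: "?LA = density ?L (\<lambda>y. ennreal (k y))"
    using D.density_RN_deriv[OF ac] density_cong[OF _ _ k(2)] by simp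
  have L_eq: "(\<integral>\<^sup>+x. v (T x) * ennreal (k (T x)) \<partial>L) = (\<integral>\<^sup>+x. v (T x) * indicator A x \<partial>L)"
    if v [measurable]: "v \<in> borel_measurable N" for v :: "'b \<Rightarrow> ennreal"
  proof -
    have "(\<integral>\<^sup>+x. v (T x) * ennreal (k (T x)) \<partial>L) = (\<integral>\<^sup>+y. v y \<partial>density ?L (\<lambda>y. ennreal (k y)))"
      by (simp add: nn_integral_density nn_integral_distr mult.commute)
    also have "\<dots> = (\<integral>\<^sup>+y. v y \<partial>?LA)" by (simp add: LA)
    also have "\<dots> = (\<integral>\<^sup>+x. v (T x) * indicator A x \<partial>L)"
      by (simp add: nn_integral_density nn_integral_distr mult.commute)
    finally show ?thesis .
  qed
  show "\<exists>k\<in>borel_measurable N. \<forall>\<theta>\<in>\<Theta>. AE x in P \<theta>.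
      real_cond_exp (P \<theta>) (vimage_algebra (space M) T N) (indicator A) x = k (T x)"
  proof (intro bexI[OF _ kN] ballI)
    fix \<theta> assume \<theta>: "\<theta> \<in> \<Theta>"
    note [measurable] = q[OF \<theta>]
    have setsP: "sets (P \<theta>) = sets L" by (simp add: dens[OF \<theta>])
    have spaceP: "space (P \<theta>) = space M"
      using sets_eq_imp_space_eq[OF setsP] sets_eq_imp_space_eq[OF sets_L] by simp
    have "AE x in P \<theta>. real_cond_exp (P \<theta>) (vimage_algebra (space (P \<theta>)) T N) (indicator A) x
        = k (T x)"
    proof (rule cond_prob_eqI[OF P[OF \<theta>] _ _ kN k(3)])
      show "T \<in> P \<theta> \<rightarrow>\<^sub>M N" using TL by (simp add: measurable_cong_sets[OF setsP refl])
      show "A \<in> sets (P \<theta>)" using A by (simp add: setsP)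
      fix u :: "'b \<Rightarrow> ennreal" assume [measurable]: "u \<in> borel_measurable N"
      have "(\<integral>\<^sup>+x. u (T x) * ennreal (k (T x)) \<partial>P \<theta>)
          = (\<integral>\<^sup>+x. (q \<theta> (T x) * u (T x)) * ennreal (k (T x)) \<partial>L)"
        unfolding dens[OF \<theta>] by (simp add: nn_integral_density mult.assoc)
      also have "\<dots> = (\<integral>\<^sup>+x. (q \<theta> (T x) * u (T x)) * indicator A x \<partial>L)"
        by (rule L_eq) simp
      also have "\<dots> = (\<integral>\<^sup>+x. u (T x) * indicator A x \<partial>P \<theta>)"
        unfolding dens[OF \<theta>] by (simp add: nn_integral_density mult.assoc)
      finally show "(\<integral>\<^sup>+x. u (T x) * ennreal (k (T x)) \<partial>P \<theta>)
          = (\<integral>\<^sup>+x. u (T x) * indicator A x \<partial>P \<theta>)" .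
    qed
    then show "AE x in P \<theta>. real_cond_exp (P \<theta>) (vimage_algebra (space M) T N) (indicator A) x
        = k (T x)"
      by (simp add: spaceP)
  qed
qed (fact T)

text \<open>The density is that of the image of \<open>P\<^sub>\<theta>\<close> under \<open>T\<close> with respect to the image of \<open>L\<close>, pulled
  back along \<open>T\<close>. In general this gives the correct mass only to events determined by \<open>T\<close>.
  Sufficiency extends it to any event \<open>A\<close>: the probability of \<open>A\<close> is the integral of the conditional
  probability given \<open>T\<close>, which is common to \<open>P\<^sub>\<theta>\<close> and \<open>L\<close> because \<open>L\<close> is a mixture of members of the
  family.\<close>

lemma sufficient_statistic_imp_densities_factor:
  fixes c :: "nat \<Rightarrow> ennreal"
  assumes suff: "sufficient_statistic M \<Theta> P N T"
    and P: "\<And>\<theta>. \<theta> \<in> \<Theta> \<Longrightarrow> prob_space (P \<theta>) \<and> sets (P \<theta>) = sets M"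
    and "finite_measure L" and sets_L: "sets L = sets M"
    and t: "\<And>i. t i \<in> \<Theta>"
    and mix: "\<And>u. u \<in> borel_measurable M \<Longrightarrow>
      (\<integral>\<^sup>+x. u x \<partial>L) = (\<Sum>i. c i * (\<integral>\<^sup>+x. u x \<partial>P (t i)))"
    and \<theta>: "\<theta> \<in> \<Theta>" and ac: "absolutely_continuous L (P \<theta>)"
  obtains D where "D \<in> borel_measurable N" and "\<And>y. 0 \<le> D y"
    and "P \<theta> = density L (\<lambda>x. ennreal (D (T x)))"
proof -
  interpret finite_measure L by fact
  have T [measurable]: "T \<in> M \<rightarrow>\<^sub>M N"
    using suff by (simp add: sufficient_statistic_def)
  have TL [measurable]: "T \<in> L \<rightarrow>\<^sub>M N"
    using T by (simp add: measurable_cong_sets[OF sets_L refl])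
  have TP: "T \<in> P \<eta> \<rightarrow>\<^sub>M N" if "\<eta> \<in> \<Theta>" for \<eta>
    using T P[OF that] by (simp cong: measurable_cong_sets)
  have spaceP: "space (P \<eta>) = space M" if "\<eta> \<in> \<Theta>" for \<eta>
    using P[OF that] by (metis sets_eq_imp_space_eq)
  note [measurable] = TP[OF \<theta>]
  let ?L = "distr L N T" and ?P = "distr (P \<theta>) N T"
  interpret D: finite_measure ?L by (rule finite_measure_distr) fact
  have fin: "finite_measure ?P"
    using P[OF \<theta>] by (intro finite_measure.finite_measure_distr) (auto simp: prob_space_def)
  have ac': "absolutely_continuous ?L ?P"
    unfolding absolutely_continuous_def
  proof
    fix B assume "B \<in> null_sets ?L"
    then have B: "B \<in> sets N" and 0: "T -` B \<inter> space L \<in> null_sets L"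
      by (auto simp: null_sets_def emeasure_distr)
    have "T -` B \<inter> space L \<in> null_sets (P \<theta>)"
      using 0 ac by (auto simp: absolutely_continuous_def)
    moreover have "space L = space (P \<theta>)"
      using spaceP[OF \<theta>] sets_eq_imp_space_eq[OF sets_L] by simp
    ultimately show "B \<in> null_sets ?P"
      using B by (auto simp: null_sets_def emeasure_distr)
  qed
  obtain D where D: "D \<in> borel_measurable ?L" "AE y in ?L. RN_deriv ?L ?P y = ennreal (D y)"
      "\<And>y. 0 \<le> D y"
    using D.real_RN_deriv[OF fin ac'] by auto
  have DN [measurable]: "D \<in> borel_measurable N" using D(1) by simp
  have distrP: "?P = density ?L (\<lambda>y. ennreal (D y))"
    using D.density_RN_deriv[OF ac'] density_cong[OF _ _ D(2)] by simp
  have "P \<theta> = density L (\<lambda>x. ennreal (D (T x)))"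
  proof (rule measure_eqI)
    show "sets (P \<theta>) = sets (density L (\<lambda>x. ennreal (D (T x))))"
      using P[OF \<theta>] by (simp add: sets_L)
    fix A assume "A \<in> sets (P \<theta>)"
    then have A [measurable]: "A \<in> sets M" using P[OF \<theta>] by simp
    then have AL [measurable]: "A \<in> sets L" by (simp add: sets_L)
    obtain k where k [measurable]: "k \<in> borel_measurable N" and
      "\<And>\<eta>. \<eta> \<in> \<Theta> \<Longrightarrow> AE x in P \<eta>.
        real_cond_exp (P \<eta>) (vimage_algebra (space M) T N) (indicator A) x = k (T x)"
      using suff A unfolding sufficient_statistic_def by blast
    then have k_eq: "(\<integral>\<^sup>+x. u (T x) * ennreal (k (T x)) \<partial>P \<eta>)
        = (\<integral>\<^sup>+x. u (T x) * indicator A x \<partial>P \<eta>)"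
      if "\<eta> \<in> \<Theta>" "u \<in> borel_measurable N" for \<eta> and u :: "_ \<Rightarrow> ennreal"
      using that P A by (intro nn_integral_cond_prob) (auto simp: spaceP TP)
    have "emeasure (P \<theta>) A = (\<integral>\<^sup>+x. 1 * indicator A x \<partial>P \<theta>)"
      using A P[OF \<theta>] by simp
    also have "\<dots> = (\<integral>\<^sup>+x. 1 * ennreal (k (T x)) \<partial>P \<theta>)"
      by (rule k_eq[symmetric, OF \<theta>]) simp
    also have "\<dots> = (\<integral>\<^sup>+y. ennreal (k y) \<partial>?P)"
      by (simp add: nn_integral_distr)
    also have "\<dots> = (\<integral>\<^sup>+x. ennreal (D (T x)) * ennreal (k (T x)) \<partial>L)"
      unfolding distrP by (simp add: nn_integral_density nn_integral_distr)
    \<comment> \<open>The common version \<open>k\<close> serves every \<open>P (t i)\<close>, hence also their mixture \<open>L\<close>.\<close>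
    also have "\<dots> = (\<Sum>i. c i * (\<integral>\<^sup>+x. ennreal (D (T x)) * ennreal (k (T x)) \<partial>P (t i)))"
      by (rule mix) simp
    also have "\<dots> = (\<Sum>i. c i * (\<integral>\<^sup>+x. ennreal (D (T x)) * indicator A x \<partial>P (t i)))"
      using t by (subst k_eq) auto
    also have "\<dots> = (\<integral>\<^sup>+x. ennreal (D (T x)) * indicator A x \<partial>L)"
      by (rule mix[symmetric]) simp
    also have "\<dots> = emeasure (density L (\<lambda>x. ennreal (D (T x)))) A"
      by (simp add: emeasure_density)
    finally show "emeasure (P \<theta>) A = emeasure (density L (\<lambda>x. ennreal (D (T x)))) A" .
  qed
  with DN D(3) show thesis by (rule that)
qed

section \<open>A countable mixture equivalent to a dominated family\<close>

definition mixture_density :: "('t \<Rightarrow> 'a \<Rightarrow> real) \<Rightarrow> (nat \<Rightarrow> 't) \<Rightarrow> 'a \<Rightarrow> ennreal" where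
  "mixture_density p t x = (\<Sum>i. ennreal ((1/2) ^ Suc i) * ennreal (p (t i) x))"

lemma mixture_density_eq_0D:
  assumes "mixture_density p t x = 0"
  shows "p (t i) x \<le> 0"
proof -
  have "(\<Sum>j. ennreal ((1/2) ^ Suc j) * ennreal (p (t j) x)) = 0"
    using assms by (simp add: mixture_density_def)
  then have "ennreal ((1/2) ^ Suc i) * ennreal (p (t i) x) = 0"
    by (subst (asm) suminf_eq_zero_iff) auto
  then have "ennreal ((1/2) ^ Suc i) = 0 \<or> ennreal (p (t i) x) = 0"
    by simp
  moreover have "ennreal ((1/2) ^ Suc i) \<noteq> 0"
    unfolding ennreal_eq_0_iff not_le by (rule zero_less_power) simp
  ultimately show ?thesis by (metis ennreal_eq_0_iff)
qed

lemma borel_measurable_mixture_density: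
  assumes "density_versions \<Theta> P \<mu> p" "range t \<subseteq> \<Theta>"
  shows "mixture_density p t \<in> borel_measurable \<mu>"
proof -
  have [measurable]: "p (t i) \<in> borel_measurable \<mu>" for i
    using assms by (auto simp: density_versions_def)
  show ?thesis unfolding mixture_density_def[abs_def] by measurable
qed

lemma nn_integral_mixture:
  assumes p: "density_versions \<Theta> P \<mu> p" and t: "range t \<subseteq> \<Theta>"
    and u [measurable]: "u \<in> borel_measurable \<mu>"
  shows "(\<integral>\<^sup>+x. u x \<partial>density \<mu> (mixture_density p t))
    = (\<Sum>i. ennreal ((1/2) ^ Suc i) * (\<integral>\<^sup>+x. u x \<partial>P (t i)))"
proof -
  have [measurable]: "p (t i) \<in> borel_measurable \<mu>" for i
    using p t by (auto simp: density_versions_def)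
  have P: "P (t i) = density \<mu> (\<lambda>x. ennreal (p (t i) x))" for i
    using p t by (auto simp: density_versions_def)
  have "(\<integral>\<^sup>+x. u x \<partial>density \<mu> (mixture_density p t))
      = (\<integral>\<^sup>+x. (\<Sum>i. ennreal ((1/2) ^ Suc i) * (ennreal (p (t i) x) * u x)) \<partial>\<mu>)"
    using borel_measurable_mixture_density[OF p t]
    by (simp add: nn_integral_density) (simp add: mixture_density_def mult.assoc flip: ennreal_suminf_multc)
  also have "\<dots> = (\<Sum>i. \<integral>\<^sup>+x. ennreal ((1/2) ^ Suc i) * (ennreal (p (t i) x) * u x) \<partial>\<mu>)"
    by (rule nn_integral_suminf) measurable
  also have "\<dots> = (\<Sum>i. ennreal ((1/2) ^ Suc i) * (\<integral>\<^sup>+x. u x \<partial>P (t i)))"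
    by (simp add: nn_integral_cmult P nn_integral_density)
  finally show ?thesis .
qed

lemma prob_space_mixture:
  assumes p: "density_versions \<Theta> P \<mu> p" and t: "range t \<subseteq> \<Theta>"
    and P: "\<And>\<theta>. \<theta> \<in> \<Theta> \<Longrightarrow> prob_space (P \<theta>)"
  shows "prob_space (density \<mu> (mixture_density p t))"
proof
  have "emeasure (P (t i)) (space (P (t i))) = 1" for i
    using P t by (intro prob_space.emeasure_space_1) auto
  moreover have "(\<Sum>i. ennreal ((1/2) ^ Suc i)) = 1"
  proof -
    have "(\<Sum>i. ennreal ((1/2) ^ Suc i)) = ennreal (\<Sum>i. (1/2) ^ Suc i)"
      by (rule suminf_ennreal2[OF _ sums_summable[OF power_half_series]]) simp
    also have "(\<Sum>i. (1/2) ^ Suc i) = (1 :: real)"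
      by (rule sums_unique[OF power_half_series, symmetric])
    finally show ?thesis by simp
  qed
  ultimately have "(\<integral>\<^sup>+x. 1 \<partial>density \<mu> (mixture_density p t)) = 1"
    using nn_integral_mixture[OF p t, of "\<lambda>_. 1"] by simp
  then show "emeasure (density \<mu> (mixture_density p t))
      (space (density \<mu> (mixture_density p t))) = 1"
    by simp
qed

text \<open>Measure the union of the supports \<open>{p\<^sub>\<theta> \<noteq> 0}\<close>, \<open>\<theta> \<in> C\<close>, by a finite measure equivalent to \<open>\<mu>\<close>
  and choose a countable \<open>C\<close> for which it is maximal. The maximum is attained because a countable
  union of countable sets is countable. Adding one more parameter cannot enlarge the union by more
  than a null set, hence every support is almost contained in it.\<close>

lemma exists_equivalent_mixture:
  assumes "sigma_finite_measure \<mu>" and p: "density_versions \<Theta> P \<mu> p" and "\<Theta> \<noteq> {}"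
  obtains t where "range t \<subseteq> \<Theta>"
    and "\<And>\<theta>. \<theta> \<in> \<Theta> \<Longrightarrow> AE x in \<mu>. mixture_density p t x = 0 \<longrightarrow> p \<theta> x = 0"
proof -
  interpret sigma_finite_measure \<mu> by fact
  obtain h where h [measurable]: "h \<in> borel_measurable \<mu>" and "integral\<^sup>N \<mu> h \<noteq> \<infinity>"
    and h_pos: "\<And>x. x \<in> space \<mu> \<Longrightarrow> 0 < h x"
    using Ex_finite_integrable_function by auto
  let ?\<nu> = "density \<mu> h"
  interpret \<nu>: finite_measure ?\<nu>
    by (rule finite_measureI)
       (use \<open>integral\<^sup>N \<mu> h \<noteq> \<infinity>\<close> in \<open>simp add: emeasure_density cong: nn_integral_cong\<close>)
  have [measurable]: "p \<theta> \<in> borel_measurable \<mu>" if "\<theta> \<in> \<Theta>" for \<theta>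
    using p that by (auto simp: density_versions_def)
  define S where "S C = (\<Union>\<theta>\<in>C. {x \<in> space \<mu>. p \<theta> x \<noteq> 0})" for C
  have S_meas [measurable]: "S C \<in> sets \<mu>" if "countable C" "C \<subseteq> \<Theta>" for C
    unfolding S_def using that by (intro sets.countable_UN') auto
  let ?V = "(\<lambda>C. emeasure ?\<nu> (S C)) ` {C. countable C \<and> C \<subseteq> \<Theta>}"
  have "?V \<noteq> {}" by auto
  from ennreal_Sup_countable_SUP[OF this]
  obtain f :: "nat \<Rightarrow> ennreal" where f: "range f \<subseteq> ?V" and Sup_V: "Sup ?V = (SUP i. f i)"
    by auto
  have "\<forall>n. \<exists>C. countable C \<and> C \<subseteq> \<Theta> \<and> f n = emeasure ?\<nu> (S C)"
    using f by auto
  then obtain C where C: "\<And>n. countable (C n)" "\<And>n. C n \<subseteq> \<Theta>"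
      "\<And>n. f n = emeasure ?\<nu> (S (C n))"
    by metis
  obtain \<theta>\<^sub>0 where "\<theta>\<^sub>0 \<in> \<Theta>" using \<open>\<Theta> \<noteq> {}\<close> by auto
  \<comment> \<open>Adjoining \<open>\<theta>\<^sub>0\<close> only makes the set nonempty, so that a sequence can enumerate it.\<close>
  define C' where "C' = insert \<theta>\<^sub>0 (\<Union>n. C n)"
  have C': "countable C'" "C' \<subseteq> \<Theta>" "C' \<noteq> {}"
    using C \<open>\<theta>\<^sub>0 \<in> \<Theta>\<close> by (auto simp: C'_def)
  have "Sup ?V \<le> emeasure ?\<nu> (S C')"
    unfolding Sup_V C(3)
  proof (rule SUP_least)
    fix n
    show "emeasure ?\<nu> (S (C n)) \<le> emeasure ?\<nu> (S C')"
      using S_meas[OF C'(1,2)] by (intro emeasure_mono) (auto simp: S_def C'_def)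
  qed
  moreover have "emeasure ?\<nu> (S D) \<le> Sup ?V" if "countable D" "D \<subseteq> \<Theta>" for D
    using that by (intro SUP_upper) simp
  ultimately have max: "emeasure ?\<nu> (S D) \<le> emeasure ?\<nu> (S C')"
    if "countable D" "D \<subseteq> \<Theta>" for D
    using that by (meson order_trans)
  define t where "t = from_nat_into C'"
  have range_t: "range t = C'"
    unfolding t_def using C' by (intro range_from_nat_into)
  show thesis
  proof (rule that)
    show "range t \<subseteq> \<Theta>" using C' range_t by simp
    fix \<theta> assume \<theta>: "\<theta> \<in> \<Theta>"
    let ?D = "insert \<theta> C'"
    have D: "countable ?D" "?D \<subseteq> \<Theta>" using C' \<theta> by auto
    have sub: "S C' \<subseteq> S ?D" by (auto simp: S_def)
    have "emeasure ?\<nu> (S ?D - S C') = emeasure ?\<nu> (S ?D) - emeasure ?\<nu> (S C')"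
      using C' D sub by (intro emeasure_Diff) auto
    also have "\<dots> = 0"
      using max[OF D] by (simp add: diff_eq_0_iff_ennreal less_top[symmetric])
    finally have "S ?D - S C' \<in> null_sets ?\<nu>"
      using C' D by (auto simp: null_sets_def)
    then have "AE x in \<mu>. x \<in> S ?D - S C' \<longrightarrow> h x = 0"
      by (subst (asm) null_sets_density_iff) auto
    then show "AE x in \<mu>. mixture_density p t x = 0 \<longrightarrow> p \<theta> x = 0"
      using AE_space
    proof eventually_elim
      case (elim x)
      show ?case
      proof
        assume 0: "mixture_density p t x = 0"
        have "p \<eta> x = 0" if \<eta>: "\<eta> \<in> C'" for \<eta>
        proof -
          obtain i where i: "\<eta> = t i" using \<eta> range_t by auto
          have "0 \<le> p \<eta> x"
            using p C' \<eta> elim by (auto simp: density_versions_def)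
          with mixture_density_eq_0D[OF 0, of i] show ?thesis by (simp add: i)
        qed
        then have "x \<notin> S C'" by (auto simp: S_def)
        then have "x \<notin> S ?D"
          using elim h_pos[of x] by auto
        then show "p \<theta> x = 0"
          using elim by (auto simp: S_def)
      qed
    qed
  qed
qed

text \<open>Cancelling \<open>m \<sqdot> (f / m) = f\<close> fails only where \<open>m = \<infinity>\<close>, or where \<open>m = 0 < f\<close>; the hypotheses
  confine both to null sets.\<close>

lemma density_eq_density_quotient:
  fixes m f :: "'a \<Rightarrow> ennreal"
  assumes [measurable]: "m \<in> borel_measurable \<mu>" "f \<in> borel_measurable \<mu>"
    and fin: "AE x in \<mu>. m x \<noteq> \<infinity>" and dom: "AE x in \<mu>. m x = 0 \<longrightarrow> f x = 0"
  shows "density \<mu> f = density (density \<mu> m) (\<lambda>x. f x / m x)"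
proof -
  have "AE x in \<mu>. f x = m x * (f x / m x)"
    using fin dom
  proof eventually_elim
    case (elim x)
    then show ?case
      by (cases "m x = 0")
         (auto simp: ennreal_times_divide ennreal_mult_divide_eq mult.commute[of "m x"])
  qed
  then have "density \<mu> f = density \<mu> (\<lambda>x. m x * (f x / m x))"
    by (intro density_cong) auto
  then show ?thesis
    by (simp add: density_density_eq)
qed

section \<open>Invariant functions and the orbit space\<close>

lemma measurable_orbit: "orbit G \<phi> \<in> M \<rightarrow>\<^sub>M orbit_space G M \<phi>"
  by (rule measurableI) (auto simp: space_orbit_space sets_orbit_space orbits_def)

text \<open>The inverse image of \<open>h -` B\<close> under the orbit map is \<open>f -` B\<close>, so measurability of \<open>h\<close> for the
  quotient \<open>\<sigma>\<close>-algebra is literally measurability of \<open>f\<close>.\<close>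

lemma invariant_function_factors_through_orbits:
  assumes "group_action G (space M) \<phi>" and f: "f \<in> M \<rightarrow>\<^sub>M N"
    and inv: "\<And>g x. g \<in> carrier G \<Longrightarrow> x \<in> space M \<Longrightarrow> f (\<phi> g x) = f x"
  obtains h where "h \<in> orbit_space G M \<phi> \<rightarrow>\<^sub>M N"
    and "\<And>x. x \<in> space M \<Longrightarrow> f x = h (orbit G \<phi> x)"
proof -
  interpret group_action G "space M" \<phi> by fact
  define h where "h o' = f (SOME x. x \<in> o')" for o'
  have h: "h (orbit G \<phi> x) = f x" if x: "x \<in> space M" for x
  proof -
    have "(SOME y. y \<in> orbit G \<phi> x) \<in> orbit G \<phi> x"
      using orbit_refl[OF x] by (rule someI)
    then show ?thesis
      using inv x by (auto simp: h_def orbit_def)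
  qed
  have "h \<in> orbit_space G M \<phi> \<rightarrow>\<^sub>M N"
  proof (rule measurableI)
    fix y assume "y \<in> space (orbit_space G M \<phi>)"
    then show "h y \<in> space N"
      using measurable_space[OF f] by (auto simp: space_orbit_space orbits_def h)
  next
    fix B assume "B \<in> sets N"
    have "orbit G \<phi> -` (h -` B \<inter> orbits G (space M) \<phi>) \<inter> space M = f -` B \<inter> space M"
      by (auto simp: h orbits_def)
    with measurable_sets[OF f \<open>B \<in> sets N\<close>]
    show "h -` B \<inter> space (orbit_space G M \<phi>) \<in> sets (orbit_space G M \<phi>)"
      by (simp add: sets_orbit_space space_orbit_space)
  qed
  with h show thesis by (intro that) auto
qed

section \<open>Minimal sufficiency of the orbit map\<close>

lemma likelihood_ratio_constantI:
  fixes m :: "'a \<Rightarrow> real" and g :: "'t \<Rightarrow> 'a \<Rightarrow> real"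
  assumes "0 < m x" "0 < m x'" and "\<And>\<theta>. \<theta> \<in> \<Theta> \<Longrightarrow> 0 \<le> g \<theta> x"
    and "\<And>\<theta>. \<theta> \<in> \<Theta> \<Longrightarrow> g \<theta> x = g \<theta> x'"
  shows "likelihood_ratio_constant \<Theta> (\<lambda>\<theta> x. m x * g \<theta> x) x x'"
  unfolding likelihood_ratio_constant_def
proof (intro exI[of _ "ennreal (m x / m x')"] ballI impI)
  fix \<theta> assume \<theta>: "\<theta> \<in> \<Theta>" and nz: "\<not> (m x * g \<theta> x = 0 \<and> m x' * g \<theta> x' = 0)"
  then have "0 < g \<theta> x" using assms(3,4)[OF \<theta>] by (cases "g \<theta> x = 0") auto
  then show "ennreal (m x * g \<theta> x) / ennreal (m x' * g \<theta> x') = ennreal (m x / m x')"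
    using assms(1,2) assms(4)[OF \<theta>] by (simp add: divide_ennreal)
qed

theorem theorem2:
  fixes G :: "('g, 'm) monoid_scheme" and \<tau> :: "'g topology"
    and M :: "'a measure" and \<phi> :: "'g \<Rightarrow> 'a \<Rightarrow> 'a"
    and \<Theta> :: "'t set" and P :: "'t \<Rightarrow> 'a measure" and \<mu> :: "'a measure"
    and p :: "'t \<Rightarrow> 'a \<Rightarrow> real"
  assumes "compact_group G \<tau>"
    and "measurable_action G \<tau> M \<phi>"
    and "dominated_family M \<Theta> P \<mu>"
    and "density_versions \<Theta> P \<mu> p"
    and "\<And>g x \<theta>. g \<in> carrier G \<Longrightarrow> x \<in> space M \<Longrightarrow> \<theta> \<in> \<Theta> \<Longrightarrow> p \<theta> (\<phi> g x) = p \<theta> x"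
    and "orbits_distinguishable G M \<phi> \<Theta> P \<mu>"
  shows "minimal_sufficient_statistic TYPE('c) M \<Theta> P (orbit_space G M \<phi>) (orbit G \<phi>)"
proof (cases "\<Theta> = {}")
  case True
  \<comment> \<open>Every measurable set is null for the empty family, in particular the whole sample space.\<close>
  then have null: "space M \<in> family_null_sets M \<Theta> P"
    by (simp add: family_null_sets_def)
  have "sufficient_statistic M \<Theta> P (orbit_space G M \<phi>) (orbit G \<phi>)"
    unfolding sufficient_statistic_def True
    by (intro conjI measurable_orbit ballI bexI[of _ "\<lambda>_. 0"]) simp_all
  with null show ?thesis
    unfolding minimal_sufficient_statistic_def
    by (intro conjI allI impI exI[of _ "\<lambda>_. {}"] bexI[OF _ null]) simp_all
next
  case False
  have act: "group_action G (space M) \<phi>"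
    using assms(2) by (simp add: measurable_action_def)
  have \<mu>: "sigma_finite_measure \<mu>" and sets_\<mu>: "sets \<mu> = sets M"
    and P: "\<And>\<theta>. \<theta> \<in> \<Theta> \<Longrightarrow> prob_space (P \<theta>) \<and> sets (P \<theta>) = sets M"
    using assms(3) by (auto simp: dominated_family_def)
  note space_\<mu> = sets_eq_imp_space_eq[OF sets_\<mu>]
  note p = assms(4)
  have pm [measurable]: "p \<theta> \<in> borel_measurable \<mu>" if "\<theta> \<in> \<Theta>" for \<theta>
    using p that by (auto simp: density_versions_def)
  have P_eq: "P \<theta> = density \<mu> (\<lambda>x. ennreal (p \<theta> x))" if "\<theta> \<in> \<Theta>" for \<theta>
    using p that by (auto simp: density_versions_def)
  obtain t where t: "range t \<subseteq> \<Theta>"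
    and t_dom: "\<And>\<theta>. \<theta> \<in> \<Theta> \<Longrightarrow> AE x in \<mu>. mixture_density p t x = 0 \<longrightarrow> p \<theta> x = 0"
    using exists_equivalent_mixture[OF \<mu> p False] by blast
  define m where "m = mixture_density p t"
  define L where "L = density \<mu> m"
  have m [measurable]: "m \<in> borel_measurable \<mu>"
    unfolding m_def by (rule borel_measurable_mixture_density[OF p t])
  have sets_L: "sets L = sets M" by (simp add: L_def sets_\<mu>)
  interpret L: prob_space L
    unfolding L_def m_def using P by (intro prob_space_mixture[OF p t]) auto
  have L_fin: "finite_measure L" by unfold_locales
  have "(\<integral>\<^sup>+x. m x \<partial>\<mu>) = emeasure L (space L)"
    by (simp add: L_def emeasure_density cong: nn_integral_cong)
  then have m_fin: "AE x in \<mu>. m x \<noteq> \<infinity>"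
    by (intro nn_integral_PInf_AE) (auto simp: L.emeasure_space_1)
  have P_L: "P \<theta> = density L (\<lambda>x. ennreal (p \<theta> x) / m x)" if \<theta>: "\<theta> \<in> \<Theta>" for \<theta>
    unfolding P_eq[OF \<theta>] L_def
    using \<theta> m m_fin t_dom[OF \<theta>, folded m_def] by (intro density_eq_density_quotient) auto
  have ac: "absolutely_continuous L (P \<theta>)" if \<theta>: "\<theta> \<in> \<Theta>" for \<theta>
    unfolding P_L[OF \<theta>] using \<theta> by (intro absolutely_continuousI_density) (simp add: L_def)

  have suff: "sufficient_statistic M \<Theta> P (orbit_space G M \<phi>) (orbit G \<phi>)"
  proof -
    have "\<exists>q. q \<in> borel_measurable (orbit_space G M \<phi>) \<and>
        (\<forall>x\<in>space M. ennreal (p \<theta> x) / m x = q (orbit G \<phi> x))" if \<theta>: "\<theta> \<in> \<Theta>" for \<theta>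
    proof -
      have "(\<lambda>x. ennreal (p \<theta> x) / m x) \<in> borel_measurable \<mu>" using \<theta> by measurable
      then have "(\<lambda>x. ennreal (p \<theta> x) / m x) \<in> borel_measurable M"
        by (simp add: measurable_cong_sets[OF sets_\<mu> refl])
      moreover have "ennreal (p \<theta> (\<phi> g x)) / m (\<phi> g x) = ennreal (p \<theta> x) / m x"
        if g: "g \<in> carrier G" "x \<in> space M" for g x
      proof -
        have "p (t i) (\<phi> g x) = p (t i) x" for i
          using assms(5)[OF g] t by auto
        then show ?thesis
          using assms(5)[OF g \<theta>] by (simp add: m_def mixture_density_def)
      qed
      ultimately show ?thesis
        by (rule invariant_function_factors_through_orbits[OF act]) auto
    qed
    then obtain q where q: "\<And>\<theta>. \<theta> \<in> \<Theta> \<Longrightarrow> q \<theta> \<in> borel_measurable (orbit_space G M \<phi>)"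
      "\<And>\<theta> x. \<theta> \<in> \<Theta> \<Longrightarrow> x \<in> space M \<Longrightarrow> ennreal (p \<theta> x) / m x = q \<theta> (orbit G \<phi> x)"
      by metis
    have orb: "orbit G \<phi> \<in> L \<rightarrow>\<^sub>M orbit_space G M \<phi>"
      using measurable_orbit by (simp add: measurable_cong_sets[OF sets_L refl])
    show ?thesis
    proof (rule sufficient_statistic_if_densities_factor[OF L_fin sets_L _ measurable_orbit q(1)])
      fix \<theta> assume \<theta>: "\<theta> \<in> \<Theta>"
      show "prob_space (P \<theta>)" using P[OF \<theta>] by simp
      show "P \<theta> = density L (\<lambda>x. q \<theta> (orbit G \<phi> x))"
        unfolding P_L[OF \<theta>] using \<theta> q orb sets_eq_imp_space_eq[OF sets_L]
        by (intro density_cong measurable_compose[OF orb q(1)]) (auto simp: L_def)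
    qed
  qed

  have "\<exists>f. \<exists>Z\<in>family_null_sets M \<Theta> P. \<forall>x\<in>space M - Z. orbit G \<phi> x = f (T x)"
    if T: "sufficient_statistic M \<Theta> P K T" for K :: "'c measure" and T
  proof -
    have TM: "T \<in> M \<rightarrow>\<^sub>M K" using T by (simp add: sufficient_statistic_def)
    then have [measurable]: "T \<in> \<mu> \<rightarrow>\<^sub>M K"
      by (simp add: measurable_cong_sets[OF sets_\<mu> refl])
    have mix: "(\<integral>\<^sup>+x. u x \<partial>L) = (\<Sum>i. ennreal ((1/2) ^ Suc i) * (\<integral>\<^sup>+x. u x \<partial>P (t i)))"
      if "u \<in> borel_measurable M" for u
      unfolding L_def m_def using that
      by (intro nn_integral_mixture[OF p t]) (simp add: measurable_cong_sets[OF sets_\<mu> refl])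
    have "\<exists>D. D \<in> borel_measurable K \<and> (\<forall>y. 0 \<le> D y) \<and>
        P \<theta> = density L (\<lambda>x. ennreal (D (T x)))" if \<theta>: "\<theta> \<in> \<Theta>" for \<theta>
      using sufficient_statistic_imp_densities_factor[OF T P L_fin sets_L _ mix \<theta> ac[OF \<theta>]] t
      by (metis range_subsetD)
    then obtain D where D: "\<And>\<theta>. \<theta> \<in> \<Theta> \<Longrightarrow> D \<theta> \<in> borel_measurable K"
      "\<And>\<theta> y. \<theta> \<in> \<Theta> \<Longrightarrow> 0 \<le> D \<theta> y"
      "\<And>\<theta>. \<theta> \<in> \<Theta> \<Longrightarrow> P \<theta> = density L (\<lambda>x. ennreal (D \<theta> (T x)))"
      by metis
    \<comment> \<open>On the null set where \<open>m = \<infinity>\<close>, \<^const>\<open>enn2real\<close> returns 0, which keeps the version real.\<close>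
    define r where "r \<theta> x = enn2real (m x) * D \<theta> (T x)" for \<theta> x
    have "density_versions \<Theta> P \<mu> r"
      unfolding density_versions_def
    proof (intro ballI conjI)
      fix \<theta> assume \<theta>: "\<theta> \<in> \<Theta>"
      note [measurable] = D(1)[OF \<theta>]
      show rm [measurable]: "r \<theta> \<in> borel_measurable \<mu>"
        unfolding r_def by measurable
      show "0 \<le> r \<theta> x" for x using D(2)[OF \<theta>] by (simp add: r_def)
      have "AE x in \<mu>. m x * ennreal (D \<theta> (T x)) = ennreal (r \<theta> x)"
        using m_fin by eventually_elim (simp add: r_def ennreal_mult D(2)[OF \<theta>] less_top)
      then show "P \<theta> = density \<mu> (\<lambda>x. ennreal (r \<theta> x))"
        unfolding D(3)[OF \<theta>] L_def
        by (subst density_density_eq) (auto intro!: density_cong)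
    qed
    then obtain Z where Z: "Z \<in> family_null_sets M \<Theta> P"
      and Z_dist: "\<And>x x'. x \<in> space M - Z \<Longrightarrow> x' \<in> space M - Z \<Longrightarrow>
        orbit G \<phi> x \<noteq> orbit G \<phi> x' \<Longrightarrow> \<not> likelihood_ratio_constant \<Theta> r x x'"
      using assms(6) unfolding orbits_distinguishable_def by blast
    define Z' where "Z' = {x \<in> space M. m x = 0 \<or> m x = \<infinity>}"
    have Z'_meas: "Z' \<in> sets \<mu>"
      unfolding Z'_def space_\<mu>[symmetric] by measurable
    have "AE x in \<mu>. x \<in> Z' \<longrightarrow> m x = 0"
      using m_fin by eventually_elim (simp add: Z'_def)
    then have "Z' \<in> null_sets L"
      unfolding L_def by (subst null_sets_density_iff) (use Z'_meas in auto)
    then have Z'_null: "emeasure (P \<theta>) Z' = 0" if "\<theta> \<in> \<Theta>" for \<theta>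
      using ac[OF that] by (auto simp: absolutely_continuous_def)
    have "emeasure (P \<theta>) (Z \<union> Z') = 0" if "\<theta> \<in> \<Theta>" for \<theta>
      using Z Z'_null[OF that] Z'_meas that P[OF that]
      by (intro emeasure_Un_null_set[THEN trans]) (auto simp: family_null_sets_def null_sets_def sets_\<mu>)
    then have null: "Z \<union> Z' \<in> family_null_sets M \<Theta> P"
      using Z Z'_meas by (auto simp: family_null_sets_def sets_\<mu>)
    have same: "orbit G \<phi> x = orbit G \<phi> x'"
      if x: "x \<in> space M - (Z \<union> Z')" "x' \<in> space M - (Z \<union> Z')" and eq: "T x = T x'" for x x'
    proof (rule ccontr)
      assume "orbit G \<phi> x \<noteq> orbit G \<phi> x'"
      then have "\<not> likelihood_ratio_constant \<Theta> r x x'" using x by (intro Z_dist) auto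
      moreover have "0 < enn2real (m x)" "0 < enn2real (m x')"
        using x by (auto simp: Z'_def enn2real_positive_iff less_top zero_less_iff_neq_zero)
      then have "likelihood_ratio_constant \<Theta> r x x'"
        unfolding r_def[abs_def]
        by (rule likelihood_ratio_constantI) (use D(2) eq in auto)
      ultimately show False by simp
    qed
    \<comment> \<open>By \<open>same\<close>, any point of the fibre outside the null set determines the orbit.\<close>
    define f where "f y = orbit G \<phi> (SOME x. x \<in> space M - (Z \<union> Z') \<and> T x = y)" for y
    have "orbit G \<phi> x = f (T x)" if x: "x \<in> space M - (Z \<union> Z')" for x
    proof -
      let ?x = "SOME x'. x' \<in> space M - (Z \<union> Z') \<and> T x' = T x"
      have "?x \<in> space M - (Z \<union> Z') \<and> T ?x = T x"
        by (rule someI[of _ x]) (use x in simp)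
      then have "orbit G \<phi> ?x = orbit G \<phi> x"
        using x by (intro same) auto
      then show ?thesis by (simp add: f_def)
    qed
    with null show ?thesis by blast
  qed
  with suff show ?thesis
    by (auto simp: minimal_sufficient_statistic_def)
qed

end
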